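(* Let $0<q<p\le1$ and let $k$ be a positive integer. Then, as formal power series in $t$, $$\frac{\mathrm{Lif}_{k,p,q}(\ln(1+t))}{(1+t)^x}=\sum_{n=0}^\infty C_{n,p,q}^{(k)}(x)\frac{t^n}{n!},$$ where $\mathrm{Lif}_{k,p,q}(t)=\sum_{n=0}^\infty\frac{t^n}{n!\,[n+1]_{p,q}^k}$.
   Context: $[n]_{p,q}=\frac{p^n-q^n}{p-q}$. For $0<q<p\le1$ the $(p,q)$-integral is $\int_0^x f(t)\,d_{p,q}t=(p-q)x\sum_{n=0}^\infty \frac{q^n}{p^{n+1}}f\!\left(\frac{q^n}{p^{n+1}}x\right)$. Let $(y)_n=y(y-1)\cdots(y-n+1)$, $(y)_0=1$. The $(p,q)$-poly-Cauchy polynomials of the first kind are $C_{n,p,q}^{(k)}(x)=\int_0^1\cdots\int_0^1 (t_1\cdots t_k-x)_n\,d_{p,q}t_1\cdots d_{p,q}t_k$ ($k$-fold). *)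

theory Defs
  imports Complex_Main "HOL-Computational_Algebra.Formal_Power_Series"
begin

definition pq_number :: "real \<Rightarrow> real \<Rightarrow> nat \<Rightarrow> real" where
  "pq_number p q n = (p ^ n - q ^ n) / (p - q)"

definition pq_integral :: "real \<Rightarrow> real \<Rightarrow> (real \<Rightarrow> 'a::real_normed_vector) \<Rightarrow> real \<Rightarrow> 'a" where
  "pq_integral p q f x =
     ((p - q) * x) *\<^sub>R (\<Sum>n. (q ^ n / p ^ (n + 1)) *\<^sub>R f (q ^ n / p ^ (n + 1) * x))"

text \<open>
  The iterated integral over the unit cube of a function of the list \<open>[t\<^sub>1, \<dots>, t\<^sub>k]\<close>;
  the innermost integration is with respect to \<open>t\<^sub>1\<close>, the outermost with respect to \<open>t\<^sub>k\<close>.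
\<close>

primrec pq_iterated_integral ::
  "real \<Rightarrow> real \<Rightarrow> nat \<Rightarrow> (real list \<Rightarrow> 'a::real_normed_vector) \<Rightarrow> 'a" where
  "pq_iterated_integral p q 0 F = F []"
| "pq_iterated_integral p q (Suc k) F =
     pq_integral p q (\<lambda>t. pq_iterated_integral p q k (\<lambda>ts. F (ts @ [t]))) 1"

definition falling_factorial :: "'a::comm_ring_1 \<Rightarrow> nat \<Rightarrow> 'a" where
  "falling_factorial y n = (\<Prod>i<n. y - of_nat i)"

definition pq_poly_cauchy ::
  "real \<Rightarrow> real \<Rightarrow> nat \<Rightarrow> nat \<Rightarrow> 'a::real_normed_field \<Rightarrow> 'a" where
  "pq_poly_cauchy p q k n x =
     pq_iterated_integral p q k (\<lambda>ts. falling_factorial (of_real (prod_list ts) - x) n)"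

definition pq_Lif :: "real \<Rightarrow> real \<Rightarrow> nat \<Rightarrow> 'a::real_normed_field fps" where
  "pq_Lif p q k = Abs_fps (\<lambda>n. 1 / (fact n * of_real (pq_number p q (n + 1)) ^ k))"

end

theory Submission
  imports Defs
begin

unbundle fps_syntax

text \<open>
  Since \<open>(1+t)^(y-x) = exp (y ln (1+t)) / (1+t)^x\<close>, the falling factorial \<open>(y - x)\<^sub>n / n!\<close> is a
  polynomial in \<open>y\<close> whose coefficient at \<open>y^m\<close> is \<open>1/m!\<close> times the \<open>n\<close>-th coefficient of
  \<open>ln (1+t)^m / (1+t)^x\<close>. Each \<open>(p,q)\<close>-integration of \<open>y = t\<^sub>1 \<cdots> t\<^sub>k\<close> multiplies the \<open>y^m\<close> term by
  \<open>1 / [m+1]\<close>, by a geometric series; so \<open>exp\<close> is replaced by \<open>Lif\<^sub>k\<close>.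
\<close>

text \<open>At upper limit 1 the weight \<open>q ^ n / p ^ (n + 1)\<close> equals the node, so the
  moment of order \<open>m\<close> sums the powers \<open>Suc m\<close> of the nodes: a geometric
  series of ratio \<open>(q / p) ^ Suc m\<close>, convergent since \<open>q < p\<close>.\<close>

lemma pq_moment_sums:
  fixes p q :: real
  assumes "0 < q" "q < p"
  shows "(\<lambda>n. (p - q) * (q ^ n / p ^ (n + 1)) ^ Suc m) sums (1 / pq_number p q (m + 1))"
proof -
  define r where "r = (q / p) ^ Suc m"
  have "r < 1"
    unfolding r_def using assms by (intro power_Suc_less_one) auto
  moreover have "0 \<le> r"
    using assms by (simp add: r_def)
  ultimately have "(\<lambda>n. (p - q) / p ^ Suc m * r ^ n) sums ((p - q) / p ^ Suc m * (1 / (1 - r)))"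
    by (intro sums_mult geometric_sums) auto
  moreover have "(p - q) / p ^ Suc m * r ^ n = (p - q) * (q ^ n / p ^ (n + 1)) ^ Suc m" for n
  proof -
    have "(q ^ n / p ^ (n + 1)) ^ Suc m = ((q / p) ^ n / p) ^ Suc m"
      by (simp add: power_divide mult.commute)
    also have "\<dots> = r ^ n / p ^ Suc m"
      by (simp only: r_def power_divide power_commutes flip: power_mult) (simp add: mult.commute)
    finally show ?thesis by simp
  qed
  moreover have "(p - q) / p ^ Suc m * (1 / (1 - r)) = 1 / pq_number p q (m + 1)"
  proof -
    have "p ^ Suc m * (1 - r) = p ^ Suc m - q ^ Suc m"
      using assms by (simp add: r_def power_divide right_diff_distrib del: power_Suc)
    then show ?thesis
      by (simp add: pq_number_def del: power_Suc)
  qed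
  ultimately show ?thesis by simp
qed

lemma pq_integral_polynomial:
  fixes c :: "nat \<Rightarrow> 'a::real_normed_field"
  assumes "0 < q" "q < p"
  shows "pq_integral p q (\<lambda>t. \<Sum>m\<le>N. c m * of_real t ^ m) 1
       = (\<Sum>m\<le>N. c m / of_real (pq_number p q (m + 1)))"
proof -
  let ?u = "\<lambda>n. q ^ n / p ^ (n + 1)"
  have "(\<lambda>n. \<Sum>m\<le>N. c m * of_real ((p - q) * ?u n ^ Suc m)) sums
          (\<Sum>m\<le>N. c m * of_real (1 / pq_number p q (m + 1)))"
    by (intro sums_sum sums_mult sums_of_real pq_moment_sums assms)
  moreover have "(\<Sum>m\<le>N. c m * of_real ((p - q) * ?u n ^ Suc m))
      = (p - q) *\<^sub>R (?u n *\<^sub>R (\<Sum>m\<le>N. c m * of_real (?u n) ^ m))" for n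
    by (simp add: scaleR_conv_of_real sum_distrib_left mult_ac)
  ultimately have s: "(\<lambda>n. (p - q) *\<^sub>R (?u n *\<^sub>R (\<Sum>m\<le>N. c m * of_real (?u n) ^ m))) sums
      (\<Sum>m\<le>N. c m * of_real (1 / pq_number p q (m + 1)))"
    by simp
  \<comment> \<open>\<open>pq_integral\<close> keeps \<open>p - q\<close> outside its series, so
    this factor is divided out to obtain the sum of the series itself.\<close>
  from sums_scaleR_right[OF s, of "1 / (p - q)"] assms
  have "(\<lambda>n. ?u n *\<^sub>R (\<Sum>m\<le>N. c m * of_real (?u n) ^ m)) sums
      ((1 / (p - q)) *\<^sub>R (\<Sum>m\<le>N. c m * of_real (1 / pq_number p q (m + 1))))"
    by simp
  then show ?thesis
    using assms
    by (simp add: pq_integral_def sums_iff del: power_Suc of_real_divide of_real_power)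
       simp
qed

lemma pq_iterated_integral_polynomial:
  fixes c :: "nat \<Rightarrow> 'a::real_normed_field"
  assumes "0 < q" "q < p"
  shows "pq_iterated_integral p q k (\<lambda>ts. \<Sum>m\<le>N. c m * of_real (prod_list ts) ^ m)
       = (\<Sum>m\<le>N. c m / of_real (pq_number p q (m + 1)) ^ k)"
proof (induction k arbitrary: c)
  case 0
  show ?case by simp
next
  case (Suc k)
  \<comment> \<open>The power \<open>t ^ m\<close> of the outermost variable is absorbed into the
    coefficients; hence the induction over arbitrary \<open>c\<close>.\<close>
  have "pq_iterated_integral p q k (\<lambda>ts. \<Sum>m\<le>N. c m * of_real (prod_list (ts @ [t])) ^ m)
      = (\<Sum>m\<le>N. c m / of_real (pq_number p q (m + 1)) ^ k * of_real t ^ m)" for t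
    using Suc.IH[of "\<lambda>m. c m * of_real t ^ m"] by (simp add: power_mult_distrib mult_ac)
  then show ?case
    by (simp only: pq_iterated_integral.simps pq_integral_polynomial[OF assms])
       (simp add: field_simps)
qed

text \<open>As \<open>b\<close> has no constant term, \<open>b ^ m\<close> has no terms below degree
  \<open>m\<close>; so all coefficients of the composition up to degree \<open>n\<close> can be
  summed over the same range \<open>m \<le> n\<close>, and the sums can be swapped.\<close>

lemma fps_compose_mult_nth:
  fixes a b c :: "'a::idom fps"
  assumes "b $ 0 = 0"
  shows "((a oo b) * c) $ n = (\<Sum>m\<le>n. a $ m * (b ^ m * c) $ n)"
proof -
  have "(a oo b) $ j = (\<Sum>m\<le>n. a $ m * b ^ m $ j)" if "j \<le> n" for j
    unfolding fps_compose_nth using that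
    by (intro sum.mono_neutral_left) (auto simp: startsby_zero_power_prefix[OF assms])
  then have "((a oo b) * c) $ n = (\<Sum>j=0..n. (\<Sum>m\<le>n. a $ m * b ^ m $ j) * c $ (n - j))"
    unfolding fps_mult_nth by (intro sum.cong) auto
  also have "\<dots> = (\<Sum>m\<le>n. a $ m * (b ^ m * c) $ n)"
    unfolding fps_mult_nth sum_distrib_left sum_distrib_right
    by (subst sum.swap) (simp add: mult_ac)
  finally show ?thesis .
qed

text \<open>Both sides solve (1 + X) f' = y f with constant term 1, which determines the
  series.\<close>

lemma fps_exp_compose_ln: "fps_exp y oo fps_ln 1 = fps_binomial (y::'a::field_char_0)"
proof -
  have "fps_deriv (fps_exp y oo fps_ln 1) = fps_const y * (fps_exp y oo fps_ln 1) / (1 + fps_X)"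
    by (simp add: fps_compose_deriv fps_ln_deriv fps_divide_unit fps_const_mult_apply_left)
  then show ?thesis
    by (subst fps_binomial_ODE_unique'[symmetric]) simp
qed

lemma falling_factorial_diff_expansion:
  fixes x y :: "'a::field_char_0"
  shows "falling_factorial (y - x) n
       = (\<Sum>m\<le>n. fact n * (fps_ln 1 ^ m * fps_binomial (- x)) $ n / fact m * y ^ m)"
proof -
  have "falling_factorial (y - x) n = fact n * fps_binomial (y + - x) $ n"
    by (simp add: falling_factorial_def gbinomial_mult_fact atLeast0LessThan)
  \<comment> \<open>Additivity in the exponent isolates \<open>y\<close> in the exponential
    factor.\<close>
  also have "fps_binomial (y + - x) = (fps_exp y oo fps_ln 1) * fps_binomial (- x)"
    by (simp only: fps_binomial_add_mult fps_exp_compose_ln)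
  finally show ?thesis
    by (simp only: fps_compose_mult_nth[OF fps_ln_0] sum_distrib_left) (simp add: mult_ac)
qed

text \<open>Brings the quotient into the product form to which \<open>fps_compose_mult_nth\<close>
  applies.\<close>

lemma fps_divide_binomial: "f / fps_binomial x = f * fps_binomial (- x :: 'a::field_char_0)"
proof -
  have "fps_binomial x * fps_binomial (- x) = 1"
    by (simp flip: fps_binomial_add_mult)
  then have "inverse (fps_binomial x) = fps_binomial (- x)"
    by (rule fps_inverse_unique)
  then show ?thesis
    by (simp add: fps_divide_unit)
qed

theorem theorem11:
  fixes p q :: real and k :: nat and x :: "'a::{real_normed_field, banach}"
  assumes "0 < q" and "q < p" and "p \<le> 1" and "0 < k"
  shows "(pq_Lif p q k oo fps_ln 1) / fps_binomial x
       = Abs_fps (\<lambda>n. pq_poly_cauchy p q k n x / fact n)"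
proof (rule fps_ext)
  fix n
  \<comment> \<open>The expansion is used with the product of the integration variables as
    \<open>y\<close>; its coefficients are free of these variables.\<close>
  have "pq_poly_cauchy p q k n x / fact n
      = (\<Sum>m\<le>n. fact n * (fps_ln 1 ^ m * fps_binomial (- x)) $ n / fact m
                / of_real (pq_number p q (m + 1)) ^ k) / fact n"
    unfolding pq_poly_cauchy_def falling_factorial_diff_expansion
    by (simp only: pq_iterated_integral_polynomial[OF assms(1,2)])
  also have "\<dots> = (\<Sum>m\<le>n. pq_Lif p q k $ m * (fps_ln 1 ^ m * fps_binomial (- x)) $ n)"
    by (simp add: pq_Lif_def sum_divide_distrib)
  also have "\<dots> = ((pq_Lif p q k oo fps_ln 1) / fps_binomial x) $ n"
    by (simp add: fps_divide_binomial fps_compose_mult_nth)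
  finally show "((pq_Lif p q k oo fps_ln 1) / fps_binomial x) $ n
      = Abs_fps (\<lambda>n. pq_poly_cauchy p q k n x / fact n) $ n"
    by simp
qed

end
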